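(* Let $k\in\mathbb{N}$, let $\boldsymbol p=(p_1,\ldots,p_k)\in\mathbb{R}^k$ be a probability distribution on $\{1,\ldots,k\}$, let $n\in\mathbb{N}$, and let $X_1,\ldots,X_n$ be independent random variables, each distributed according to $\boldsymbol p$. Let $J_n=\sum_{j=1}^k\left|\hat p^{(n)}_j-p_j\right|$, where $\hat p^{(n)}_j$ is the empirical frequency of $j$. Then $$P(J_n>\varepsilon)\le\exp\left(-\frac n2\left(\varepsilon-\sqrt{\frac kn}\right)^2\right)\qquad\text{for all }\varepsilon\ge\sqrt{\frac kn}.$$
   Context: $\mathbb{N}=\{1,2,\ldots\}$. A distribution $\boldsymbol p\in\mathbb{R}^k$ is a vector of nonnegative entries summing to $1$. The empirical frequencies are $\hat p^{(n)}_j=\frac1n\sum_{i=1}^n\mathbf 1_{\{X_i=j\}}$. The random variable $J_n$ is the $\ell_1$ distance between the empirical and the true distributions. *)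

theory Defs
  imports "HOL-Probability.Probability"
begin

text \<open>A vector in \<open>\<real>\<^sup>k\<close> is represented by a function on \<open>nat\<close>, of which only the values at the
  indices \<open>1, \<dots>, k\<close> matter.\<close>

definition prob_vector :: "nat \<Rightarrow> (nat \<Rightarrow> real) \<Rightarrow> bool" where
  "prob_vector k p \<longleftrightarrow> (\<forall>j\<in>{1..k}. 0 \<le> p j) \<and> (\<Sum>j=1..k. p j) = 1"

definition emp_freq :: "nat \<Rightarrow> (nat \<Rightarrow> 'a \<Rightarrow> nat) \<Rightarrow> nat \<Rightarrow> 'a \<Rightarrow> real" where
  "emp_freq n X j \<omega> = (1 / real n) * (\<Sum>i=1..n. indicator {j} (X i \<omega>))"

definition l1_deviation :: "nat \<Rightarrow> (nat \<Rightarrow> real) \<Rightarrow> nat \<Rightarrow> (nat \<Rightarrow> 'a \<Rightarrow> nat) \<Rightarrow> 'a \<Rightarrow> real" where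
  "l1_deviation k p n X \<omega> = (\<Sum>j=1..k. \<bar>emp_freq n X j \<omega> - p j\<bar>)"

end

theory Submission
  imports Defs
begin

text \<open>Replacing one sample moves \<open>J\<^sub>n\<close> by at most \<open>2/n\<close>, so McDiarmid's bounded differences
  inequality gives \<open>P(J\<^sub>n \<ge> E J\<^sub>n + t) \<le> exp(-n t\<^sup>2/2)\<close>. The mean is controlled by
  \<open>E\<bar>emp\<^sub>j - p\<^sub>j\<bar> \<le> sqrt (Var emp\<^sub>j) \<le> sqrt (p\<^sub>j/n)\<close> and Cauchy--Schwarz, which give
  \<open>E J\<^sub>n \<le> sqrt (k/n)\<close>. McDiarmid's inequality itself follows by integrating out one coordinate at a
  time: averaging over a coordinate preserves the bounded differences in the others, and each
  average costs a factor \<open>exp(l\<^sup>2 c\<^sub>i\<^sup>2/8)\<close> by Hoeffding's lemma.\<close>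

section \<open>Exponential moments and concentration under bounded differences\<close>

lemma (in interval_bounded_random_variable) Hoeffdings_lemma_mgf:
  assumes "l > 0"
  shows "(\<integral>\<^sup>+x. ennreal (exp (l * f x)) \<partial>M)
           \<le> ennreal (exp (l\<^sup>2 * (b - a)\<^sup>2 / 8)) * ennreal (exp (l * expectation f))"
proof -
  \<comment> \<open>Splitting off the constant \<open>exp (l * expectation f)\<close> leaves the
    centred exponential of Hoeffding's lemma and keeps the mean as a separate factor for the later
    induction.\<close>
  have "(\<integral>\<^sup>+x. ennreal (exp (l * f x)) \<partial>M)
          = (\<integral>\<^sup>+x. ennreal (exp (l * (f x - expectation f))) * ennreal (exp (l * expectation f)) \<partial>M)"
    by (intro nn_integral_cong) (simp flip: ennreal_mult exp_add add: algebra_simps)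
  also have "\<dots> = (\<integral>\<^sup>+x. ennreal (exp (l * (f x - expectation f))) \<partial>M) * ennreal (exp (l * expectation f))"
    by (rule nn_integral_multc) measurable
  also have "\<dots> \<le> ennreal (exp (l\<^sup>2 * (b - a)\<^sup>2 / 8)) * ennreal (exp (l * expectation f))"
    using Hoeffdings_lemma_nn_integral[OF assms] by (intro mult_right_mono) auto
  finally show ?thesis .
qed

text \<open>The induction generalises over \<open>f\<close> because its hypothesis is applied to
  another function, the average of \<open>f\<close> over the new coordinate. Stating the exponential
  moment as a nonnegative integral lets Tonelli's theorem split off that coordinate directly. The
  bound \<open>B\<close> secures integrability of \<open>f\<close> and finiteness of the infimum
  over one coordinate.\<close>

lemma (in product_prob_space) bounded_differences_mgf:
  fixes f :: "('i \<Rightarrow> 'a) \<Rightarrow> real"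
  assumes "finite J" and "f \<in> borel_measurable (Pi\<^sub>M J M)"
    and "\<And>x. x \<in> space (Pi\<^sub>M J M) \<Longrightarrow> \<bar>f x\<bar> \<le> B"
    and "\<And>i x y. i \<in> J \<Longrightarrow> x \<in> space (Pi\<^sub>M J M) \<Longrightarrow> y \<in> space (M i) \<Longrightarrow> \<bar>f (x(i := y)) - f x\<bar> \<le> c i"
    and "l > 0"
  shows "(\<integral>\<^sup>+x. ennreal (exp (l * f x)) \<partial>Pi\<^sub>M J M)
           \<le> ennreal (exp (l\<^sup>2 * (\<Sum>i\<in>J. (c i)\<^sup>2) / 8)) * ennreal (exp (l * (\<integral>x. f x \<partial>Pi\<^sub>M J M)))"
  using assms(1-4)
proof (induction J arbitrary: f rule: finite_induct)
  case empty
  \<comment> \<open>The product over no coordinates is a single point, so both sides are the same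
    exponential.\<close>
  have "prob_space (Pi\<^sub>M {} M)"
    by (rule prob_space_PiM) simp
  then show ?case
    by (simp add: PiM_empty lebesgue_integral_count_space_finite nn_integral_count_space_finite)
next
  case (insert i J)
  note f [measurable] = insert.prems(1) and bounded = insert.prems(2) and diff = insert.prems(3)
  interpret J: prob_space "Pi\<^sub>M J M"
    by (intro prob_space_PiM prob_space)
  interpret iJ: prob_space "Pi\<^sub>M (insert i J) M"
    by (intro prob_space_PiM prob_space)
  define g where "g x = (\<integral>y. f (x(i := y)) \<partial>M i)" for x
  have upd: "x(i := y) \<in> space (Pi\<^sub>M (insert i J) M)"
    if "x \<in> space (Pi\<^sub>M J M)" "y \<in> space (M i)" for x y
    using that by (auto simp: space_PiM PiE_def extensional_def)
  have bounded_upd: "\<bar>f (x(i := y))\<bar> \<le> B" if "x \<in> space (Pi\<^sub>M J M)" "y \<in> space (M i)" for x y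
    using that by (intro bounded upd)
  have meas: "(\<lambda>y. f (x(i := y))) \<in> borel_measurable (M i)" if "x \<in> space (Pi\<^sub>M J M)" for x
    using measurable_comp[OF measurable_component_update[OF that insert.hyps(2)] f]
    by (simp add: comp_def)
  have int: "integrable (M i) (\<lambda>y. f (x(i := y)))" if "x \<in> space (Pi\<^sub>M J M)" for x
    by (intro M.integrable_const_bound[where B = B] AE_I2 meas that)
       (simp add: bounded_upd that)
  have f_int: "integrable (Pi\<^sub>M (insert i J) M) f"
    using bounded by (intro iJ.integrable_const_bound[of _ B]) auto
  have g_meas: "g \<in> borel_measurable (Pi\<^sub>M J M)"
    unfolding g_def by measurable
  have g_bound: "\<bar>g x\<bar> \<le> B" if x: "x \<in> space (Pi\<^sub>M J M)" for x
  proof -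
    have "\<bar>g x\<bar> \<le> (\<integral>y. \<bar>f (x(i := y))\<bar> \<partial>M i)"
      unfolding g_def by (rule integral_abs_bound)
    also have "\<dots> \<le> (\<integral>y. B \<partial>M i)"
      using int[OF x] by (intro integral_mono) (auto intro: bounded_upd x)
    finally show ?thesis by (simp add: M.prob_space)
  qed
  have g_diff: "\<bar>g (x(j := z)) - g x\<bar> \<le> c j"
    if j: "j \<in> J" and x: "x \<in> space (Pi\<^sub>M J M)" and z: "z \<in> space (M j)" for j x z
  proof -
    have x': "x(j := z) \<in> space (Pi\<^sub>M J M)"
      using j x z by (auto simp: space_PiM PiE_def extensional_def)
    have "i \<noteq> j" using insert.hyps(2) j by auto
    have "\<bar>g (x(j := z)) - g x\<bar> = \<bar>\<integral>y. f (x(j := z, i := y)) - f (x(i := y)) \<partial>M i\<bar>"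
      unfolding g_def using int[OF x] int[OF x'] by simp
    also have "\<dots> \<le> (\<integral>y. \<bar>f (x(j := z, i := y)) - f (x(i := y))\<bar> \<partial>M i)"
      by (rule integral_abs_bound)
    also have "\<dots> \<le> (\<integral>y. c j \<partial>M i)"
    \<comment> \<open>Updates at the distinct indices \<open>i\<close> and \<open>j\<close> commute,
      so the difference bound for \<open>f\<close> at the point \<open>x(i := y)\<close> applies
      under the integral.\<close>
    proof (rule integral_mono)
      fix y assume "y \<in> space (M i)"
      then have "\<bar>f (x(i := y, j := z)) - f (x(i := y))\<bar> \<le> c j"
        using j by (intro diff upd x z) auto
      then show "\<bar>f (x(j := z, i := y)) - f (x(i := y))\<bar> \<le> c j"
        by (subst fun_upd_twist[OF \<open>i \<noteq> j\<close>[symmetric]])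
    qed (use int[OF x] int[OF x'] in auto)
    finally show ?thesis by (simp add: M.prob_space)
  qed
  have inner: "(\<integral>\<^sup>+y. ennreal (exp (l * f (x(i := y)))) \<partial>M i)
      \<le> ennreal (exp (l\<^sup>2 * (c i)\<^sup>2 / 8)) * ennreal (exp (l * g x))"
    if x: "x \<in> space (Pi\<^sub>M J M)" for x
  proof -
    \<comment> \<open>Starting the interval at the infimum gives it length exactly
      \<open>c i\<close>. Centring it at one value of the function would only give length
      \<open>2 * c i\<close> and lose a factor 4 in the exponent.\<close>
    define a where "a = (INF y\<in>space (M i). f (x(i := y)))"
    have bdd: "bdd_below ((\<lambda>y. f (x(i := y))) ` space (M i))"
    proof (rule bdd_belowI2)
      fix y assume "y \<in> space (M i)"
      from bounded_upd[OF x this] show "- B \<le> f (x(i := y))" by linarith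
    qed
    have lower: "a \<le> f (x(i := y))" if "y \<in> space (M i)" for y
      unfolding a_def using that bdd by (rule cINF_lower[rotated])
    have upper: "f (x(i := y)) \<le> a + c i" if y: "y \<in> space (M i)" for y
    proof -
      \<comment> \<open>Any two values along coordinate \<open>i\<close> differ by at most
        \<open>c i\<close>, so each value minus \<open>c i\<close> is a lower bound for all of them
        and hence lies below the infimum.\<close>
      have "f (x(i := y)) - c i \<le> f (x(i := y'))" if "y' \<in> space (M i)" for y'
      proof -
        have "\<bar>f (x(i := y, i := y')) - f (x(i := y))\<bar> \<le> c i"
          using that by (intro diff upd x y) auto
        then show ?thesis
          unfolding fun_upd_upd by linarith
      qed
      then have "f (x(i := y)) - c i \<le> a"
        unfolding a_def by (rule cINF_greatest[OF M.not_empty])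
      then show ?thesis by simp
    qed
    interpret h: interval_bounded_random_variable "M i" "\<lambda>y. f (x(i := y))" a "a + c i"
      by unfold_locales (auto intro!: AE_I2 meas x lower upper)
    show ?thesis
      using h.Hoeffdings_lemma_mgf[OF \<open>l > 0\<close>] by (simp add: g_def)
  qed
  have "(\<integral>\<^sup>+x. ennreal (exp (l * f x)) \<partial>Pi\<^sub>M (insert i J) M)
      = (\<integral>\<^sup>+x. (\<integral>\<^sup>+y. ennreal (exp (l * f (x(i := y)))) \<partial>M i) \<partial>Pi\<^sub>M J M)"
    using insert.hyps by (intro product_nn_integral_insert) auto
  also have "\<dots> \<le> (\<integral>\<^sup>+x. ennreal (exp (l\<^sup>2 * (c i)\<^sup>2 / 8)) * ennreal (exp (l * g x)) \<partial>Pi\<^sub>M J M)"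
    by (intro nn_integral_mono inner)
  also have "\<dots> = ennreal (exp (l\<^sup>2 * (c i)\<^sup>2 / 8)) * (\<integral>\<^sup>+x. ennreal (exp (l * g x)) \<partial>Pi\<^sub>M J M)"
    using g_meas by (intro nn_integral_cmult) measurable
  also have "\<dots> \<le> ennreal (exp (l\<^sup>2 * (c i)\<^sup>2 / 8)) *
      (ennreal (exp (l\<^sup>2 * (\<Sum>j\<in>J. (c j)\<^sup>2) / 8)) * ennreal (exp (l * (\<integral>x. g x \<partial>Pi\<^sub>M J M))))"
    by (intro mult_left_mono insert.IH g_meas g_bound g_diff) auto
  \<comment> \<open>By Fubini, averaging leaves the mean unchanged, so the mean of \<open>f\<close>
    reappears in the bound for \<open>g\<close>.\<close>
  also have "(\<integral>x. g x \<partial>Pi\<^sub>M J M) = (\<integral>x. f x \<partial>Pi\<^sub>M (insert i J) M)"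
    unfolding g_def using insert.hyps f_int by (intro product_integral_insert[symmetric])
  also have "ennreal (exp (l\<^sup>2 * (c i)\<^sup>2 / 8)) *
      (ennreal (exp (l\<^sup>2 * (\<Sum>j\<in>J. (c j)\<^sup>2) / 8)) * ennreal (exp (l * (\<integral>x. f x \<partial>Pi\<^sub>M (insert i J) M))))
    = ennreal (exp (l\<^sup>2 * (\<Sum>j\<in>insert i J. (c j)\<^sup>2) / 8)) * ennreal (exp (l * (\<integral>x. f x \<partial>Pi\<^sub>M (insert i J) M)))"
    using insert.hyps by (simp add: distrib_left add_divide_distrib exp_add ennreal_mult mult.assoc)
  finally show ?case .
qed

text \<open>Independence moves the problem to a product space, where the exponential moment is
  already bounded; a Chernoff bound with the optimal parameter then gives the tail.\<close>

theorem (in prob_space) McDiarmid_ineq: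
  fixes f :: "('i \<Rightarrow> 'b) \<Rightarrow> real"
  assumes "finite I" and "I \<noteq> {}" and indep: "indep_vars N X I"
    and f [measurable]: "f \<in> borel_measurable (Pi\<^sub>M I N)"
    and bounded: "\<And>x. x \<in> space (Pi\<^sub>M I N) \<Longrightarrow> \<bar>f x\<bar> \<le> B"
    and diff: "\<And>i x y. i \<in> I \<Longrightarrow> x \<in> space (Pi\<^sub>M I N) \<Longrightarrow> y \<in> space (N i) \<Longrightarrow> \<bar>f (x(i := y)) - f x\<bar> \<le> c i"
    and pos: "(\<Sum>i\<in>I. (c i)\<^sup>2) > 0" and "t \<ge> 0"
  defines "F \<equiv> \<lambda>\<omega>. f (\<lambda>i\<in>I. X i \<omega>)"
  shows "prob {\<omega> \<in> space M. F \<omega> \<ge> expectation F + t} \<le> exp (- 2 * t\<^sup>2 / (\<Sum>i\<in>I. (c i)\<^sup>2))"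
\<comment> \<open>For \<open>t = 0\<close> the right side is 1. Otherwise the Chernoff parameter is
  strictly positive, as the moment bound demands.\<close>
proof (cases "t = 0")
  case False
  define d where "d = (\<Sum>i\<in>I. (c i)\<^sup>2)"
  \<comment> \<open>This \<open>l\<close> minimises \<open>l^2 * d / 8 - l * t\<close>, with minimum
    \<open>- 2 * t^2 / d\<close>.\<close>
  define l where "l = 4 * t / d"
  have d: "d > 0" and l: "l > 0"
    using pos False \<open>t \<ge> 0\<close> by (auto simp: d_def l_def)
  have X [measurable]: "random_variable (N i) (X i)" if "i \<in> I" for i
    using indep that by (simp add: indep_vars_def)
  have joint [measurable]: "(\<lambda>\<omega>. \<lambda>i\<in>I. X i \<omega>) \<in> measurable M (Pi\<^sub>M I N)"
    by measurable
  \<comment> \<open>\<open>product_prob_space\<close> asks for a probability measure at every index, also outside \<open>I\<close>.\<close>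
  define D where "D i = (if i \<in> I then distr M (N i) (X i) else return (count_space UNIV) undefined)" for i
  have D: "prob_space (D i)" for i
    by (auto simp: D_def intro!: prob_space_distr X prob_space_return)
  interpret D: product_prob_space D I
    by (intro product_prob_spaceI D)
  have sets_D: "sets (Pi\<^sub>M I D) = sets (Pi\<^sub>M I N)"
    by (intro sets_PiM_cong) (auto simp: D_def)
  have space_D: "space (Pi\<^sub>M I D) = space (Pi\<^sub>M I N)"
    by (rule sets_eq_imp_space_eq[OF sets_D])
  \<comment> \<open>Independence enters here: the joint law is the product of the marginal
    laws.\<close>
  have distr: "distr M (Pi\<^sub>M I N) (\<lambda>\<omega>. \<lambda>i\<in>I. X i \<omega>) = Pi\<^sub>M I D"
    using indep_vars_iff_distr_eq_PiM'[where M' = N and X = X, OF \<open>I \<noteq> {}\<close> X] indep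
    by (auto simp: D_def cong: PiM_cong)
  have fD: "f \<in> borel_measurable (Pi\<^sub>M I D)"
    using f by (simp add: measurable_cong_sets[OF sets_D refl])
  have EF: "expectation F = (\<integral>x. f x \<partial>Pi\<^sub>M I D)"
    unfolding F_def by (subst distr[symmetric], subst integral_distr) auto
  have mgf: "(\<integral>\<^sup>+\<omega>. ennreal (exp (l * F \<omega>)) \<partial>M) \<le> ennreal (exp (l\<^sup>2 * d / 8)) * ennreal (exp (l * expectation F))"
  proof -
    have "(\<integral>\<^sup>+\<omega>. ennreal (exp (l * F \<omega>)) \<partial>M) = (\<integral>\<^sup>+x. ennreal (exp (l * f x)) \<partial>Pi\<^sub>M I D)"
      unfolding F_def by (subst distr[symmetric], subst nn_integral_distr) auto
    also have "\<dots> \<le> ennreal (exp (l\<^sup>2 * d / 8)) * ennreal (exp (l * expectation F))"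
      unfolding d_def EF using diff
      by (intro D.bounded_differences_mgf[where B = B] fD bounded \<open>finite I\<close> l)
         (auto simp: space_D D_def)
    finally show ?thesis .
  qed
  have F [measurable]: "F \<in> borel_measurable M"
    unfolding F_def using joint f by (rule measurable_compose)
  have "emeasure M {\<omega> \<in> space M. F \<omega> \<ge> expectation F + t}
      \<le> ennreal (exp (- l * (expectation F + t))) * (\<integral>\<^sup>+\<omega>. ennreal (exp (l * F \<omega>)) \<partial>M)"
    using Chernoff_ineq_nn_integral_ge[OF l sets.top[of M], of F "expectation F + t"]
    by (simp cong: nn_integral_cong)
  also have "\<dots> \<le> ennreal (exp (- l * (expectation F + t))) *
      (ennreal (exp (l\<^sup>2 * d / 8)) * ennreal (exp (l * expectation F)))"
    by (intro mult_left_mono mgf) auto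
  \<comment> \<open>The two occurrences of \<open>l * expectation F\<close> in the exponents
    cancel.\<close>
  also have "\<dots> = ennreal (exp (l\<^sup>2 * d / 8 - l * t))"
    by (simp flip: ennreal_mult exp_add add: algebra_simps)
  also have "l\<^sup>2 * d / 8 - l * t = - 2 * t\<^sup>2 / d"
    using d by (simp add: l_def field_simps power2_eq_square)
  finally show ?thesis
    by (simp add: emeasure_eq_measure d_def)
qed simp


section \<open>Second moments and Cauchy-Schwarz estimates\<close>

lemma (in prob_space) expectation_square_sum_indep:
  fixes Y :: "'i \<Rightarrow> 'a \<Rightarrow> real"
  assumes "finite I" and indep: "indep_vars (\<lambda>_. borel) Y I"
    and int: "\<And>i. i \<in> I \<Longrightarrow> integrable M (Y i)"
    and int2: "\<And>i. i \<in> I \<Longrightarrow> integrable M (\<lambda>\<omega>. (Y i \<omega>)\<^sup>2)"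
    and mean: "\<And>i. i \<in> I \<Longrightarrow> expectation (Y i) = 0"
  shows "integrable M (\<lambda>\<omega>. (\<Sum>i\<in>I. Y i \<omega>)\<^sup>2)"
    and "expectation (\<lambda>\<omega>. (\<Sum>i\<in>I. Y i \<omega>)\<^sup>2) = (\<Sum>i\<in>I. expectation (\<lambda>\<omega>. (Y i \<omega>)\<^sup>2))"
proof -
  have expand: "(\<Sum>i\<in>I. Y i \<omega>)\<^sup>2 = (\<Sum>i\<in>I. \<Sum>j\<in>I. Y i \<omega> * Y j \<omega>)" for \<omega>
    by (simp add: power2_eq_square sum_product)
  \<comment> \<open>A sum over the singleton \<open>{j}\<close> is just \<open>Y j\<close>, so
    independence of one variable from a sum of others specialises to pairs.\<close>
  have pair: "indep_var borel (Y i) borel (Y j)" if "i \<in> I" "j \<in> I" "i \<noteq> j" for i j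
    using indep_vars_sum[of "{j}" i Y] indep_vars_subset[OF indep, of "{i, j}"] that by simp
  have int': "integrable M (\<lambda>\<omega>. Y i \<omega> * Y j \<omega>)" if "i \<in> I" "j \<in> I" for i j
    using that int2[of i] indep_var_integrable[OF pair int int, of i j]
    by (cases "i = j") (auto simp: power2_eq_square)
  \<comment> \<open>Off the diagonal, independence factors the expectation into a product of two
    zero means.\<close>
  have pair_mean: "expectation (\<lambda>\<omega>. Y i \<omega> * Y j \<omega>) = (if i = j then expectation (\<lambda>\<omega>. (Y i \<omega>)\<^sup>2) else 0)"
    if "i \<in> I" "j \<in> I" for i j
    using that indep_var_lebesgue_integral[OF pair int int, of i j] mean
    by (auto simp: power2_eq_square)
  show "integrable M (\<lambda>\<omega>. (\<Sum>i\<in>I. Y i \<omega>)\<^sup>2)"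
    unfolding expand using int' by auto
  have "expectation (\<lambda>\<omega>. (\<Sum>i\<in>I. Y i \<omega>)\<^sup>2) = (\<Sum>i\<in>I. \<Sum>j\<in>I. expectation (\<lambda>\<omega>. Y i \<omega> * Y j \<omega>))"
    unfolding expand using int' by (simp add: Bochner_Integration.integral_sum)
  also have "\<dots> = (\<Sum>i\<in>I. expectation (\<lambda>\<omega>. (Y i \<omega>)\<^sup>2))"
    using \<open>finite I\<close> by (simp add: pair_mean)
  finally show "expectation (\<lambda>\<omega>. (\<Sum>i\<in>I. Y i \<omega>)\<^sup>2) = (\<Sum>i\<in>I. expectation (\<lambda>\<omega>. (Y i \<omega>)\<^sup>2))" .
qed

text \<open>This is nonnegativity of the variance of the absolute value of \<open>Z\<close>.\<close>

lemma (in prob_space) expectation_abs_le_sqrt: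
  fixes Z :: "'a \<Rightarrow> real"
  assumes "integrable M Z" and "integrable M (\<lambda>\<omega>. (Z \<omega>)\<^sup>2)"
  shows "expectation (\<lambda>\<omega>. \<bar>Z \<omega>\<bar>) \<le> sqrt (expectation (\<lambda>\<omega>. (Z \<omega>)\<^sup>2))"
  using variance_eq[of "\<lambda>\<omega>. \<bar>Z \<omega>\<bar>"] variance_positive[of "\<lambda>\<omega>. \<bar>Z \<omega>\<bar>"] assms
  by (intro real_le_rsqrt) simp

text \<open>Cauchy-Schwarz for the vector of the \<open>sqrt (p j)\<close> against the all-ones
  vector.\<close>

lemma sum_sqrt_le:
  fixes p :: "'i \<Rightarrow> real"
  assumes "\<And>j. j \<in> A \<Longrightarrow> 0 \<le> p j"
  shows "(\<Sum>j\<in>A. sqrt (p j)) \<le> sqrt (card A * (\<Sum>j\<in>A. p j))"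
  using sum_squared_le_sum_of_squares[of "\<lambda>j. sqrt (p j)" A] assms
  by (intro real_le_rsqrt) (simp add: mult.commute cong: sum.cong)

section \<open>Boundedness and bounded differences of the deviation\<close>

lemma emp_freq_bounds:
  shows "0 \<le> emp_freq n X j \<omega>" and "emp_freq n X j \<omega> \<le> 1"
proof -
  have "(\<Sum>i=1..n. indicator {j} (X i \<omega>) :: real) \<le> (\<Sum>i=1..n. 1)"
    by (intro sum_mono) (simp add: indicator_def)
  then show "emp_freq n X j \<omega> \<le> 1"
    by (cases "n = 0") (simp_all add: emp_freq_def)
qed (simp add: emp_freq_def sum_nonneg)

text \<open>A crude uniform bound, to serve as \<open>B\<close> in
  \<open>McDiarmid_ineq\<close>.\<close>

lemma l1_deviation_bounded: "\<bar>l1_deviation k p n X \<omega>\<bar> \<le> (\<Sum>j=1..k. 1 + \<bar>p j\<bar>)"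
proof -
  have "\<bar>emp_freq n X j \<omega> - p j\<bar> \<le> 1 + \<bar>p j\<bar>" for j
    using emp_freq_bounds[of n X j \<omega>] by linarith
  then show ?thesis
    unfolding l1_deviation_def by (simp add: sum_nonneg sum_mono)
qed

text \<open>The sample point \<open>x\<close> is itself the list of samples, with the coordinate
  projections as random variables. Changing one sample takes mass \<open>1/n\<close> from one symbol
  and gives it to another, and each of these two changes costs at most \<open>1/n\<close>.\<close>

lemma l1_deviation_fun_upd:
  assumes "i \<in> {1..n}"
  shows "\<bar>l1_deviation k p n (\<lambda>i x. x i) (x(i := y)) - l1_deviation k p n (\<lambda>i x. x i) x\<bar> \<le> 2 / n"
proof -
  let ?e = "emp_freq n (\<lambda>i x. x i)"
  have upd: "?e j (x(i := y)) - ?e j x = (indicator {j} y - indicator {j} (x i)) / n" for j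
  proof -
    have "(\<Sum>m=1..n. indicator {j} ((x(i := y)) m)) - (\<Sum>m=1..n. indicator {j} (x m))
        = (\<Sum>m=1..n. if m = i then indicator {j} y - indicator {j} (x i) else (0::real))"
      unfolding sum_subtractf[symmetric] by (intro sum.cong) auto
    also have "\<dots> = indicator {j} y - indicator {j} (x i)"
      using assms by simp
    finally show ?thesis
      by (simp add: emp_freq_def flip: diff_divide_distrib)
  qed
  \<comment> \<open>At most one \<open>j\<close> equals \<open>z\<close>; the sum is 0 when
    \<open>z\<close> lies outside \<open>{1..k}\<close>.\<close>
  have mass: "(\<Sum>j=1..k. indicator {j} z :: real) \<le> 1" for z
    by (cases "z \<in> {1..k}") (simp_all add: indicator_def Int_insert_right del: atLeastAtMost_iff)
  have "\<bar>l1_deviation k p n (\<lambda>i x. x i) (x(i := y)) - l1_deviation k p n (\<lambda>i x. x i) x\<bar>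
      \<le> (\<Sum>j=1..k. \<bar>\<bar>?e j (x(i := y)) - p j\<bar> - \<bar>?e j x - p j\<bar>\<bar>)"
    unfolding l1_deviation_def sum_subtractf[symmetric] by (rule sum_abs)
  also have "\<dots> \<le> (\<Sum>j=1..k. (indicator {j} y + indicator {j} (x i)) / n)"
  proof (rule sum_mono)
    fix j
    have "\<bar>\<bar>?e j (x(i := y)) - p j\<bar> - \<bar>?e j x - p j\<bar>\<bar> \<le> \<bar>?e j (x(i := y)) - ?e j x\<bar>"
      by linarith
    also have "\<dots> \<le> (indicator {j} y + indicator {j} (x i)) / n"
      unfolding upd by (simp add: indicator_def)
    finally show "\<bar>\<bar>?e j (x(i := y)) - p j\<bar> - \<bar>?e j x - p j\<bar>\<bar> \<le> (indicator {j} y + indicator {j} (x i)) / n" .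
  qed
  also have "\<dots> = ((\<Sum>j=1..k. indicator {j} y) + (\<Sum>j=1..k. indicator {j} (x i))) / n"
    by (simp only: sum.distrib flip: sum_divide_distrib)
  also have "\<dots> \<le> 2 / n"
    using mass[of y] mass[of "x i"] by (intro divide_right_mono) auto
  finally show ?thesis .
qed

section \<open>The mean of the deviation\<close>

lemma (in prob_space) expectation_emp_freq_deviation_le:
  assumes "n \<ge> 1" and "prob_vector k p"
    and indep: "indep_vars (\<lambda>_. count_space {1..k}) X {1..n}"
    and dist: "\<And>i. i \<in> {1..n} \<Longrightarrow> distributed M (count_space {1..k}) (X i) (\<lambda>j. ennreal (p j))"
    and j: "j \<in> {1..k}"
  shows "integrable M (\<lambda>\<omega>. emp_freq n X j \<omega> - p j)"
    and "expectation (\<lambda>\<omega>. \<bar>emp_freq n X j \<omega> - p j\<bar>) \<le> sqrt (p j / n)"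
proof -
  define Z where "Z i \<omega> = (indicator {j} (X i \<omega>) :: real)" for i \<omega>
  define Y where "Y i \<omega> = Z i \<omega> - p j" for i \<omega>
  have p: "0 \<le> p m" if "m \<in> {1..k}" for m
    using assms(2) that by (simp add: prob_vector_def)
  have X [measurable]: "random_variable (count_space {1..k}) (X i)" if "i \<in> {1..n}" for i
    using indep that by (simp add: indep_vars_def)
  have Z_meas: "random_variable borel (Z i)" if "i \<in> {1..n}" for i
    unfolding Z_def by (rule measurable_compose[OF X[OF that]]) simp
  have Z_int: "integrable M (Z i)" if "i \<in> {1..n}" for i
    by (rule integrable_const_bound[of _ 1]) (use Z_meas[OF that] in \<open>auto simp: Z_def\<close>)
  \<comment> \<open>An indicator is its own square, so the first moment also gives the
    second.\<close>
  have Z_sq: "(Z i \<omega>)\<^sup>2 = Z i \<omega>" for i \<omega>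
    by (simp add: Z_def indicator_def)
  have EZ: "expectation (Z i) = p j" if "i \<in> {1..n}" for i
  proof -
    have "expectation (Z i) = (\<integral>x. p x * indicator {j} x \<partial>count_space {1..k})"
      unfolding Z_def by (rule distributed_integral[OF dist[OF that], symmetric]) (auto intro: p)
    also have "\<dots> = (\<Sum>x=1..k. if x = j then p x else 0)"
      unfolding lebesgue_integral_count_space_finite[OF finite_atLeastAtMost]
      by (intro sum.cong) (auto simp: indicator_def)
    also have "\<dots> = p j" using j by simp
    finally show ?thesis .
  qed
  have Y_int: "integrable M (Y i)" and EY: "expectation (Y i) = 0" if "i \<in> {1..n}" for i
    using Z_int[OF that] EZ[OF that] by (simp_all add: Y_def[abs_def] prob_space)
  have Y_int2: "integrable M (\<lambda>\<omega>. (Y i \<omega>)\<^sup>2)" if "i \<in> {1..n}" for i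
    using Z_int[OF that] by (auto simp: Y_def power2_diff Z_sq)
  \<comment> \<open>The left side is the variance \<open>p j - (p j)^2\<close> of the indicator;
    dropping the subtracted square gives the bound.\<close>
  have EY2: "expectation (\<lambda>\<omega>. (Y i \<omega>)\<^sup>2) \<le> p j" if "i \<in> {1..n}" for i
    using variance_eq[of "Z i"] Z_int[OF that] EZ[OF that] by (simp add: Y_def Z_sq)
  have indep_Y: "indep_vars (\<lambda>_. borel) Y {1..n}"
    unfolding Y_def Z_def by (rule indep_vars_compose2[OF indep]) simp
  have sum_sq: "integrable M (\<lambda>\<omega>. (\<Sum>i=1..n. Y i \<omega>)\<^sup>2)"
      "expectation (\<lambda>\<omega>. (\<Sum>i=1..n. Y i \<omega>)\<^sup>2) = (\<Sum>i=1..n. expectation (\<lambda>\<omega>. (Y i \<omega>)\<^sup>2))"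
    by (intro expectation_square_sum_indep finite_atLeastAtMost indep_Y Y_int Y_int2 EY; assumption)+
  \<comment> \<open>The error is the average of \<open>n\<close> independent centred indicators, so
    its second moment is at most \<open>n * p j / n^2\<close>.\<close>
  have emp: "emp_freq n X j \<omega> - p j = (\<Sum>i=1..n. Y i \<omega>) / n" for \<omega>
    using assms(1) by (simp add: emp_freq_def Y_def Z_def sum_subtractf field_simps)
  show int: "integrable M (\<lambda>\<omega>. emp_freq n X j \<omega> - p j)"
    unfolding emp using Y_int by (intro integrable_divide_zero Bochner_Integration.integrable_sum) auto
  have "expectation (\<lambda>\<omega>. \<bar>emp_freq n X j \<omega> - p j\<bar>) \<le> sqrt (expectation (\<lambda>\<omega>. (emp_freq n X j \<omega> - p j)\<^sup>2))"
    using int sum_sq(1) by (intro expectation_abs_le_sqrt) (auto simp: emp power_divide)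
  also have "expectation (\<lambda>\<omega>. (emp_freq n X j \<omega> - p j)\<^sup>2) = (\<Sum>i=1..n. expectation (\<lambda>\<omega>. (Y i \<omega>)\<^sup>2)) / (real n)\<^sup>2"
    by (simp add: emp power_divide sum_sq(2) del: One_nat_def)
  also have "\<dots> \<le> (\<Sum>i=1..n. p j) / (real n)\<^sup>2"
    using EY2 by (intro divide_right_mono sum_mono) auto
  also have "\<dots> = p j / n"
    using assms(1) by (simp add: power2_eq_square)
  finally show "expectation (\<lambda>\<omega>. \<bar>emp_freq n X j \<omega> - p j\<bar>) \<le> sqrt (p j / n)"
    by simp
qed

text \<open>After the coordinatewise bounds, Cauchy-Schwarz over the \<open>k\<close> symbols leaves
  only the total mass 1 of \<open>p\<close>, so the estimate is uniform in \<open>p\<close>.\<close>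

lemma (in prob_space) expectation_l1_deviation_le:
  assumes "n \<ge> 1" and "prob_vector k p"
    and "indep_vars (\<lambda>_. count_space {1..k}) X {1..n}"
    and "\<And>i. i \<in> {1..n} \<Longrightarrow> distributed M (count_space {1..k}) (X i) (\<lambda>j. ennreal (p j))"
  shows "expectation (l1_deviation k p n X) \<le> sqrt (k / n)"
proof -
  note emp = expectation_emp_freq_deviation_le[OF assms]
  have "expectation (l1_deviation k p n X) = (\<Sum>j=1..k. expectation (\<lambda>\<omega>. \<bar>emp_freq n X j \<omega> - p j\<bar>))"
    unfolding l1_deviation_def[abs_def] using emp(1) by (intro Bochner_Integration.integral_sum) auto
  also have "\<dots> \<le> (\<Sum>j=1..k. sqrt (p j / n))"
    by (intro sum_mono emp(2))
  also have "\<dots> \<le> sqrt (card {1..k} * (\<Sum>j=1..k. p j / n))"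
    using assms(2) by (intro sum_sqrt_le) (auto simp: prob_vector_def)
  also have "\<dots> = sqrt (k / n)"
    using assms(2) by (simp add: prob_vector_def flip: sum_divide_distrib)
  finally show ?thesis .
qed

section \<open>The tail bound\<close>

theorem theorem2p1:
  fixes M :: "'a measure" and k n :: nat and p :: "nat \<Rightarrow> real"
    and X :: "nat \<Rightarrow> 'a \<Rightarrow> nat" and \<epsilon> :: real
  assumes "prob_space M"
    and "k \<ge> 1" and "n \<ge> 1"
    and "prob_vector k p"
    and "prob_space.indep_vars M (\<lambda>_. count_space {1..k}) X {1..n}"
    and "\<And>i. i \<in> {1..n} \<Longrightarrow>
           distributed M (count_space {1..k}) (X i) (\<lambda>j. ennreal (p j))"
    and "\<epsilon> \<ge> sqrt (real k / real n)"
  shows "measure M {\<omega> \<in> space M. l1_deviation k p n X \<omega> > \<epsilon>}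
           \<le> exp (- (real n / 2) * (\<epsilon> - sqrt (real k / real n))\<^sup>2)"
proof -
  interpret prob_space M by fact
  define f where "f = l1_deviation k p n (\<lambda>i x. x i)"
  define t where "t = \<epsilon> - sqrt (real k / real n)"
  \<comment> \<open>Restricting to \<open>{1..n}\<close> changes nothing, since
    \<open>emp_freq\<close> reads only those indices.\<close>
  have F: "(\<lambda>\<omega>. f (\<lambda>i\<in>{1..n}. X i \<omega>)) = l1_deviation k p n X"
    by (simp add: f_def l1_deviation_def emp_freq_def fun_eq_iff)
  have f: "f \<in> borel_measurable (Pi\<^sub>M {1..n} (\<lambda>_. count_space {1..k}))"
  proof -
    have "(\<lambda>x. indicator {j} (x i) :: real) \<in> borel_measurable (Pi\<^sub>M {1..n} (\<lambda>_. count_space {1..k}))"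
      if "i \<in> {1..n}" for i j
      by (rule measurable_compose[OF measurable_component_singleton[OF that]]) simp
    then show ?thesis
      unfolding f_def l1_deviation_def[abs_def] emp_freq_def
      by (intro borel_measurable_sum borel_measurable_abs borel_measurable_diff
          borel_measurable_times borel_measurable_const)
  qed
  have X: "X i \<in> measurable M (count_space {1..k})" if "i \<in> {1..n}" for i
    using assms(5) that by (simp add: indep_vars_def)
  have meas: "l1_deviation k p n X \<in> borel_measurable M"
    unfolding F[symmetric] by (rule measurable_compose[OF measurable_restrict f]) (rule X)
  have E: "expectation (l1_deviation k p n X) \<le> sqrt (real k / real n)"
    using assms(3-6) by (rule expectation_l1_deviation_le)
  \<comment> \<open>By \<open>E\<close> and the choice of \<open>t\<close>, the threshold
    \<open>expectation (l1_deviation k p n X) + t\<close> is at most \<epsilon>, so the event only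
    grows.\<close>
  have "prob {\<omega> \<in> space M. l1_deviation k p n X \<omega> > \<epsilon>}
      \<le> prob {\<omega> \<in> space M. l1_deviation k p n X \<omega> \<ge> expectation (l1_deviation k p n X) + t}"
    using E meas by (intro finite_measure_mono) (auto simp: t_def)
  also have "\<dots> \<le> exp (- 2 * t\<^sup>2 / (\<Sum>i\<in>{1..n}. (2 / real n)\<^sup>2))"
    unfolding F[symmetric]
  proof (rule McDiarmid_ineq[OF _ _ assms(5) f])
    show "\<bar>f x\<bar> \<le> (\<Sum>j=1..k. 1 + \<bar>p j\<bar>)" for x
      unfolding f_def by (rule l1_deviation_bounded)
    show "\<bar>f (x(i := y)) - f x\<bar> \<le> 2 / real n" if "i \<in> {1..n}" for i x y
      unfolding f_def using that by (rule l1_deviation_fun_upd)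
  qed (use assms(3,7) in \<open>auto simp: t_def\<close>)
  \<comment> \<open>The squared differences add up to \<open>n * (2/n)^2 = 4/n\<close>.\<close>
  also have "- 2 * t\<^sup>2 / (\<Sum>i\<in>{1..n}. (2 / real n)\<^sup>2) = - (real n / 2) * t\<^sup>2"
    using assms(3) by (simp add: power2_eq_square field_simps)
  finally show ?thesis
    unfolding t_def .
qed

end
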